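(* Let $\mathbb{F}_q$ be a finite field with $q$ elements and let $L$ be a three-dimensional Lie algebra over $\mathbb{F}_q$ with $\dim L'=2$. Put $V=L'$ and suppose that for some $x\in L\setminus L'$ the restriction $\operatorname{ad} x|_V : V\to V$ is a nonzero scalar multiple of the identity. Then the number of triangles in the comaximal graph $\Gamma(L)$ is $$\mathfrak{t}(\Gamma(L)) = \frac{q(q+1)(4q^4+2q^3+q^2-3q-1)}{6}.$$
   Context: For a finite-dimensional Lie algebra $L$, $L'=[L,L]$ is the derived algebra. The comaximal graph $\Gamma(L)$ is the simple undirected graph whose vertices are the proper nonzero Lie subalgebras of $L$; two distinct vertices $A,B$ are adjacent if and only if the Lie subalgebra $\langle A,B\rangle$ generated by $A\cup B$ equals $L$. A triangle of a graph is a set of three pairwise adjacent vertices, and $\mathfrak{t}(\Gamma)$ denotes the number of triangles of $\Gamma$. *)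

theory Defs
  imports Complex_Main "HOL-Library.Cardinality"
begin

text \<open>The underlying vector space is the whole type \<open>'v\<close>; the field is the type \<open>'k\<close>.\<close>

locale lie_algebra = vector_space scale
  for scale :: "'k::field \<Rightarrow> 'v::ab_group_add \<Rightarrow> 'v" +
  fixes bracket :: "'v \<Rightarrow> 'v \<Rightarrow> 'v"
  assumes bracket_add_left: "bracket (x + y) z = bracket x z + bracket y z"
    and bracket_add_right: "bracket x (y + z) = bracket x y + bracket x z"
    and bracket_scale_left: "bracket (scale a x) y = scale a (bracket x y)"
    and bracket_scale_right: "bracket x (scale a y) = scale a (bracket x y)"
    and bracket_self: "bracket x x = 0"
    and jacobi: "bracket x (bracket y z) + bracket y (bracket z x) + bracket z (bracket x y) = 0"
begin

definition ad :: "'v \<Rightarrow> 'v \<Rightarrow> 'v"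
  where "ad x = (\<lambda>y. bracket x y)"

definition derived_algebra :: "'v set"
  where "derived_algebra = span {bracket x y | x y. True}"

definition lie_subalgebra :: "'v set \<Rightarrow> bool"
  where "lie_subalgebra S \<longleftrightarrow> subspace S \<and> (\<forall>x\<in>S. \<forall>y\<in>S. bracket x y \<in> S)"

definition generated_subalgebra :: "'v set \<Rightarrow> 'v set"
  where "generated_subalgebra X = lie_subalgebra hull X"

lemma lie_subalgebra_generated: "lie_subalgebra (generated_subalgebra X)"
  unfolding generated_subalgebra_def
  by (rule hull_in) (auto simp: lie_subalgebra_def intro: subspace_Inter)

end

text \<open>A simple undirected graph is a pair of a vertex set and a set of two-element sets of
  vertices (the edges).\<close>

type_synonym 'a simple_graph = "'a set \<times> 'a set set"

definition triangles :: "'a simple_graph \<Rightarrow> 'a set set"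
  where "triangles G =
    {T. T \<subseteq> fst G \<and> card T = 3 \<and> (\<forall>a\<in>T. \<forall>b\<in>T. a \<noteq> b \<longrightarrow> {a, b} \<in> snd G)}"

context lie_algebra
begin

definition comaximal_vertices :: "'v set set"
  where "comaximal_vertices = {A. lie_subalgebra A \<and> A \<noteq> {0} \<and> A \<noteq> UNIV}"

definition comaximal_graph :: "'v set simple_graph"
  where "comaximal_graph =
    (comaximal_vertices,
     {{A, B} | A B. A \<in> comaximal_vertices \<and> B \<in> comaximal_vertices \<and> A \<noteq> B \<and>
        generated_subalgebra (A \<union> B) = UNIV})"

end

end

theory Submission
  imports Defs
begin

text \<open>
  By the Jacobi identity \<open>V\<close> is abelian, and then \<open>[a, b]\<close> always lies in the span of \<open>a\<close> and \<open>b\<close>.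
  Hence every subspace is a subalgebra, and the comaximal graph only depends on the projective
  plane of one- and two-dimensional subspaces of \<open>L\<close>.  Two distinct planes are always adjacent, a
  one-dimensional subspace is adjacent to the planes not containing it, and two one-dimensional
  subspaces never are.  So a triangle is either a set of three planes, or a pair of planes together
  with one of the \<open>q\<^sup>2 - q\<close> one-dimensional subspaces outside both; there are \<open>q\<^sup>2 + q + 1\<close> planes.
\<close>

section \<open>Counting vectors, lines and planes over a finite field\<close>

locale finite_field_space = finite_dimensional_vector_space scale Basis
  for scale :: "'k::{field,finite} \<Rightarrow> 'v::ab_group_add \<Rightarrow> 'v" and Basis :: "'v set"
begin

definition subspaces :: "nat \<Rightarrow> 'v set set"
  where "subspaces d = {P. subspace P \<and> dim P = d}"

text \<open>This is the shape \<open>comaximal_graph\<close> takes once every subspace is a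
  subalgebra; edges are therefore governed by the linear span.\<close>

definition subspace_graph :: "'v set simple_graph"
  where "subspace_graph =
    ({A. subspace A \<and> A \<noteq> {0} \<and> A \<noteq> UNIV},
     {{A, B} | A B. (subspace A \<and> A \<noteq> {0} \<and> A \<noteq> UNIV) \<and> (subspace B \<and> B \<noteq> {0} \<and> B \<noteq> UNIV) \<and>
        A \<noteq> B \<and> span (A \<union> B) = UNIV})"

lemma card_field_gt_1: "CARD('k) > 1"
proof -
  have "card {0, 1 :: 'k} \<le> CARD('k)" by (intro card_mono) auto
  then show ?thesis by simp
qed

text \<open>Each vector of \<open>span (insert b B)\<close> is \<open>scale k b + v\<close> for
  exactly one scalar \<open>k\<close> and one \<open>v\<close> in \<open>span B\<close>, so every
  basis vector contributes a factor \<open>CARD('k)\<close>.\<close>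

lemma card_span_independent:
  assumes "independent B"
  shows "card (span B) = CARD('k) ^ card B"
proof -
  have "finite B" using assms by (rule finiteI_independent)
  then show ?thesis using assms
  proof (induction B rule: finite_induct)
    case empty
    then show ?case by simp
  next
    case (insert b B)
    have ind: "independent B" and b: "b \<notin> span B"
      using insert.prems insert.hyps(2) by (auto simp: independent_insert)
    have "bij_betw (\<lambda>(k, v). scale k b + v) (UNIV \<times> span B) (span (insert b B))"
      unfolding bij_betw_def
    proof
      show "inj_on (\<lambda>(k, v). scale k b + v) (UNIV \<times> span B)"
      proof (clarsimp simp: inj_on_def)
        fix k k' v v'
        assume v: "v \<in> span B" "v' \<in> span B" and eq: "scale k b + v = scale k' b + v'"
        have "scale (k - k') b = v' - v"
          using eq by (simp add: scale_left_diff_distrib algebra_simps)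
        then have *: "scale (k - k') b \<in> span B" using v by (simp add: span_diff)
        have "k = k'"
        proof (rule ccontr)
          assume "k \<noteq> k'"
          then have "b \<in> span B"
            using span_scale[OF *, of "inverse (k - k')"] by simp
          with b show False by simp
        qed
        with eq show "k = k' \<and> v = v'" by simp
      qed
      show "(\<lambda>(k, v). scale k b + v) ` (UNIV \<times> span B) = span (insert b B)"
      proof (intro equalityI subsetI)
        fix y assume "y \<in> (\<lambda>(k, v). scale k b + v) ` (UNIV \<times> span B)"
        then show "y \<in> span (insert b B)"
          by (auto simp: span_insert) (metis add_diff_cancel_left')
      next
        fix y assume "y \<in> span (insert b B)"
        then obtain k where "y - scale k b \<in> span B" by (auto simp: span_insert)
        then show "y \<in> (\<lambda>(k, v). scale k b + v) ` (UNIV \<times> span B)"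
          by (intro image_eqI[where x = "(k, y - scale k b)"]) auto
      qed
    qed
    then have "card (span (insert b B)) = card (UNIV \<times> span B :: ('k \<times> 'v) set)"
      by (simp add: bij_betw_same_card)
    then show ?case using insert.IH[OF ind] insert.hyps by (simp add: card_cartesian_product)
  qed
qed

lemma card_subspace:
  assumes "subspace S"
  shows "card S = CARD('k) ^ dim S"
proof -
  obtain B where B: "B \<subseteq> S" "independent B" "S \<subseteq> span B" "card B = dim S"
    using basis_exists by blast
  have "span B = S" using B assms by (simp add: span_subspace)
  then show ?thesis using card_span_independent[OF B(2)] B(4) by simp
qed

lemma finite_space: "finite (UNIV :: 'v set)"
  \<comment> \<open>An infinite set has \<open>card\<close> equal to 0, so a positive power of the
    field size already forces finiteness.\<close>
  using card_subspace[OF subspace_UNIV] card_field_gt_1 by (intro card_ge_0_finite) simp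

lemma finite_vectors [simp]: "finite (S :: 'v set)"
  by (rule finite_subset[OF subset_UNIV finite_space])

lemma finite_subspaces [simp]: "finite (subspaces d)"
  by (rule finite_subset[OF subset_UNIV]) (simp add: Finite_Set.finite_set)

lemma dim_pair:
  assumes "u \<noteq> 0" "v \<notin> span {u}"
  shows "dim (span {u, v}) = 2"
proof -
  have "dim {v, u} = 2" using assms by (simp add: dim_insert)
  then show ?thesis by (simp add: insert_commute)
qed

lemma line_eq_span:
  assumes "P \<in> subspaces 1" "u \<in> P" "u \<noteq> 0"
  shows "P = span {u}"
proof -
  have "subspace P" "dim P = 1" using assms by (auto simp: subspaces_def)
  moreover have "dim (span {u}) = 1" using assms by (simp add: dim_insert)
  moreover have "span {u} \<subseteq> P" using assms(2) \<open>subspace P\<close> by (simp add: span_minimal)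
  ultimately show ?thesis using subspace_dim_equal[of "span {u}" P] by simp
qed

text \<open>A set of nonzero vectors closed under nonzero scaling is the disjoint union of the
  punctured lines inside it, and each of these has \<open>CARD('k) - 1\<close> elements.\<close>

lemma card_lines_in_cone:
  assumes "0 \<notin> U" and scale: "\<And>k u. k \<noteq> 0 \<Longrightarrow> u \<in> U \<Longrightarrow> scale k u \<in> U"
  shows "card {P \<in> subspaces 1. P - {0} \<subseteq> U} * (CARD('k) - 1) = card U"
proof -
  let ?L = "{P \<in> subspaces 1. P - {0} \<subseteq> U}"
  have "U = (\<Union>P\<in>?L. P - {0})"
  proof (intro equalityI subsetI)
    fix u assume u: "u \<in> U"
    then have "u \<noteq> 0" using assms(1) by auto
    have "span {u} \<in> subspaces 1" using \<open>u \<noteq> 0\<close> by (simp add: subspaces_def dim_insert)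
    moreover have "span {u} - {0} \<subseteq> U"
    proof
      fix w assume "w \<in> span {u} - {0}"
      then obtain k where "w = scale k u" "k \<noteq> 0" by (auto simp: span_singleton)
      then show "w \<in> U" using scale u by simp
    qed
    moreover have "u \<in> span {u} - {0}" using \<open>u \<noteq> 0\<close> by (simp add: span_base)
    ultimately show "u \<in> (\<Union>P\<in>?L. P - {0})" by blast
  qed auto
  then have "card U = card (\<Union>P\<in>?L. P - {0})" by simp
  also have "\<dots> = (\<Sum>P\<in>?L. card (P - {0}))"
  proof (rule card_UN_disjoint)
    show "\<forall>P\<in>?L. \<forall>Q\<in>?L. P \<noteq> Q \<longrightarrow> (P - {0}) \<inter> (Q - {0}) = {}"
    proof (intro ballI impI equals0I)
      fix P Q u
      assume "P \<in> ?L" "Q \<in> ?L" "P \<noteq> Q" "u \<in> (P - {0}) \<inter> (Q - {0})"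
      then show False using line_eq_span[of P u] line_eq_span[of Q u] by blast
    qed
  qed auto
  also have "\<dots> = (\<Sum>P\<in>?L. CARD('k) - 1)"
    by (intro sum.cong refl) (auto simp: subspaces_def card_subspace subspace_0)
  finally show ?thesis by simp
qed

text \<open>Double counting of ordered pairs of independent vectors: every pair lies in exactly one
  plane, namely its span, and every plane contains equally many pairs.\<close>

lemma card_planes:
  defines "q \<equiv> CARD('k)"
  shows "card (subspaces 2) * ((q\<^sup>2 - 1) * (q\<^sup>2 - q)) =
    (q ^ dim UNIV - 1) * (q ^ dim UNIV - q)"
proof -
  \<comment> \<open>\<open>F P\<close> collects the ordered independent pairs of \<open>P\<close>:
    first a nonzero \<open>u\<close>, then a \<open>v\<close> off the line of
    \<open>u\<close>.\<close>
  define F where "F P = Sigma (P - {0}) (\<lambda>u. P - span {u})" for P :: "'v set"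
  have card_F: "card (F P) = (q ^ dim P - 1) * (q ^ dim P - q)" if P: "subspace P" for P
  proof -
    have "card (P - span {u}) = q ^ dim P - q" if u: "u \<in> P - {0}" for u
    proof -
      have "span {u} \<subseteq> P" using u P by (simp add: span_minimal)
      then have "card (P - span {u}) = card P - card (span {u})" by (simp add: card_Diff_subset)
      then show ?thesis using u P by (simp add: card_subspace q_def dim_insert)
    qed
    then have "card (F P) = card (P - {0}) * (q ^ dim P - q)"
      by (simp add: F_def card_SigmaI)
    then show ?thesis using P by (simp add: card_subspace q_def subspace_0)
  qed
  have "F UNIV = (\<Union>P\<in>subspaces 2. F P)"
  proof (intro equalityI subsetI)
    fix x assume "x \<in> F UNIV"
    then obtain u v where x: "x = (u, v)" and uv: "u \<noteq> 0" "v \<notin> span {u}" by (auto simp: F_def)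
    have "x \<in> F (span {u, v})" using uv x by (auto simp: F_def span_base)
    moreover have "span {u, v} \<in> subspaces 2" using dim_pair[OF uv] by (simp add: subspaces_def)
    ultimately show "x \<in> (\<Union>P\<in>subspaces 2. F P)" by blast
  qed (auto simp: F_def)
  then have "card (F UNIV) = card (\<Union>P\<in>subspaces 2. F P)" by simp
  also have "\<dots> = (\<Sum>P\<in>subspaces 2. card (F P))"
  proof (rule card_UN_disjoint)
    have span_F: "span {u, v} = P" if "P \<in> subspaces 2" "(u, v) \<in> F P" for P u v
    proof -
      have "subspace P" "dim P = 2" using that by (auto simp: subspaces_def)
      moreover have "dim (span {u, v}) = 2" using that by (intro dim_pair) (auto simp: F_def)
      moreover have "span {u, v} \<subseteq> P"
        using that \<open>subspace P\<close> by (intro span_minimal) (auto simp: F_def)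
      ultimately show ?thesis using subspace_dim_equal[of "span {u, v}" P] by simp
    qed
    show "\<forall>P\<in>subspaces 2. \<forall>Q\<in>subspaces 2. P \<noteq> Q \<longrightarrow> F P \<inter> F Q = {}"
    proof (intro ballI impI equals0I)
      fix P Q x
      assume "P \<in> subspaces 2" "Q \<in> subspaces 2" "P \<noteq> Q" "x \<in> F P \<inter> F Q"
      then show False
        using span_F[of P "fst x" "snd x"] span_F[of Q "fst x" "snd x"] by simp
    qed
    show "\<forall>P\<in>subspaces 2. finite (F P)" by (simp add: F_def)
  qed simp
  also have "\<dots> = (\<Sum>P\<in>subspaces 2. (q\<^sup>2 - 1) * (q\<^sup>2 - q))"
    by (intro sum.cong refl) (auto simp: subspaces_def card_F)
  finally show ?thesis by (simp add: card_F)
qed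

section \<open>Lines and planes in dimension three\<close>

context
  assumes dim3: "dim (UNIV :: 'v set) = 3"
begin

lemma card_planes_dim3: "card (subspaces 2) = CARD('k)\<^sup>2 + CARD('k) + 1"
proof -
  \<comment> \<open>Writing q = r + 1 removes the truncated subtractions and exposes the common
    factor \<open>r * (r + 2) * (r * Suc r)\<close>, which is then cancelled.\<close>
  obtain r where r: "CARD('k) = Suc r" "r > 0"
    using card_field_gt_1 by (metis Suc_lessE Suc_lessD One_nat_def)
  have "(Suc r)\<^sup>2 - 1 = r * (r + 2)" "(Suc r)\<^sup>2 - Suc r = r * Suc r"
    "Suc r ^ 3 - 1 = r * ((Suc r)\<^sup>2 + Suc r + 1)" "Suc r ^ 3 - Suc r = Suc r * (r * (r + 2))"
    by (simp_all add: power2_eq_square power3_eq_cube algebra_simps)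
  then have "card (subspaces 2) * (r * (r + 2) * (r * Suc r)) =
      r * ((Suc r)\<^sup>2 + Suc r + 1) * (Suc r * (r * (r + 2)))"
    using card_planes unfolding dim3 r(1) by (simp only:)
  also have "\<dots> = ((Suc r)\<^sup>2 + Suc r + 1) * (r * (r + 2) * (r * Suc r))"
    by (simp only: mult_ac)
  finally have "card (subspaces 2) * (r * (r + 2) * (r * Suc r)) =
      ((Suc r)\<^sup>2 + Suc r + 1) * (r * (r + 2) * (r * Suc r))" .
  moreover have "r * (r + 2) * (r * Suc r) \<noteq> 0" using r(2) by simp
  ultimately show ?thesis unfolding r(1) using mult_right_cancel by blast
qed

text \<open>Planes are maximal proper subspaces: a strictly larger subspace has dimension above 2,
  hence 3.\<close>

lemma span_Un_plane:
  assumes "A \<in> subspaces 2" "\<not> B \<subseteq> A"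
  shows "span (A \<union> B) = UNIV"
proof -
  have A: "subspace A" "dim A = 2" using assms by (auto simp: subspaces_def)
  have "A \<subseteq> span (A \<union> B)" using span_superset by blast
  moreover have "A \<noteq> span (A \<union> B)" using assms(2) span_superset by blast
  ultimately have "dim (span (A \<union> B)) > 2"
    using A subspace_dim_equal[of A "span (A \<union> B)"] by (metis not_less subspace_span)
  then show ?thesis using dim3 subspace_dim_equal[of "span (A \<union> B)" UNIV] by simp
qed

text \<open>Two distinct planes have sum \<open>UNIV\<close>, so the dimension formula leaves 2 + 2
  - 3 for the intersection.\<close>

lemma dim_Int_planes:
  assumes "A \<in> subspaces 2" "B \<in> subspaces 2" "A \<noteq> B"
  shows "dim (A \<inter> B) = 1"
proof -
  have A: "subspace A" "dim A = 2" "subspace B" "dim B = 2"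
    using assms by (auto simp: subspaces_def)
  then have "\<not> B \<subseteq> A" using assms(3) subspace_dim_equal[of B A] by auto
  then have "span (A \<union> B) = UNIV" by (rule span_Un_plane[OF assms(1)])
  moreover have "span A = A" "span B = B" using A by (simp_all only: span_eq_iff)
  ultimately have "{x + y |x y. x \<in> A \<and> y \<in> B} = UNIV" by (simp only: span_Un)
  then show ?thesis using dim_sums_Int[OF A(1) A(3)] A dim3 by simp
qed

text \<open>The vectors outside both planes form a cone with q^3 - (2q^2 - q) = q(q - 1)^2 elements;
  dividing by the q - 1 nonzero vectors of a line gives q^2 - q.\<close>

lemma card_lines_off_planes:
  assumes "A \<in> subspaces 2" "B \<in> subspaces 2" "A \<noteq> B"
  shows "card {P \<in> subspaces 1. \<not> P \<subseteq> A \<and> \<not> P \<subseteq> B} = CARD('k)\<^sup>2 - CARD('k)"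
proof -
  let ?U = "UNIV - (A \<union> B)"
  have A: "subspace A" "dim A = 2" "subspace B" "dim B = 2"
    using assms by (auto simp: subspaces_def)
  \<comment> \<open>Any nonzero vector of a line spans it, so a line not contained in
    \<open>S\<close> meets \<open>S\<close> only in 0.\<close>
  have off: "P - {0} \<subseteq> - S \<longleftrightarrow> \<not> P \<subseteq> S" if P: "P \<in> subspaces 1" and S: "subspace S" for P S
  proof
    assume "P - {0} \<subseteq> - S"
    moreover have "P \<noteq> {0}" using P by (auto simp: subspaces_def)
    moreover have "0 \<in> P" using P by (auto simp: subspaces_def subspace_0)
    ultimately show "\<not> P \<subseteq> S" by blast
  next
    assume "\<not> P \<subseteq> S"
    then show "P - {0} \<subseteq> - S"
      using line_eq_span[OF P] S by (metis ComplI DiffE empty_subsetI insert_subset singletonI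
          span_minimal subsetI)
  qed
  have "{P \<in> subspaces 1. P - {0} \<subseteq> ?U} = {P \<in> subspaces 1. \<not> P \<subseteq> A \<and> \<not> P \<subseteq> B}"
    using off[OF _ A(1)] off[OF _ A(3)] by blast
  moreover have "card {P \<in> subspaces 1. P - {0} \<subseteq> ?U} * (CARD('k) - 1) = card ?U"
  proof (rule card_lines_in_cone)
    show "0 \<notin> ?U" using A by (simp add: subspace_0)
    have "scale k u \<notin> S" if "k \<noteq> 0" "u \<notin> S" "subspace S" for k u S
      using that subspace_scale[of S "scale k u" "inverse k"] by auto
    then show "scale k u \<in> ?U" if "k \<noteq> 0" "u \<in> ?U" for k u
      using that A by blast
  qed
  moreover have "card ?U + card (A \<union> B) = CARD('k) ^ 3"
    using card_subspace[OF subspace_UNIV] dim3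
      card_Diff_subset[of "A \<union> B" UNIV] card_mono[of UNIV "A \<union> B"] by simp
  \<comment> \<open>Inclusion-exclusion; the summand \<open>CARD('k)\<close> is the size of the line
    \<open>A \<inter> B\<close>.\<close>
  moreover have "card (A \<union> B) + CARD('k) = 2 * CARD('k)\<^sup>2"
    using card_Un_Int[of A B] A dim_Int_planes[OF assms]
    by (simp add: card_subspace subspace_inter)
  moreover obtain r where r: "CARD('k) = Suc r" "r > 0"
    using card_field_gt_1 by (metis Suc_lessE Suc_lessD One_nat_def)
  ultimately have "card {P \<in> subspaces 1. \<not> P \<subseteq> A \<and> \<not> P \<subseteq> B} * r = (r * Suc r) * r"
    by (simp add: power2_eq_square power3_eq_cube algebra_simps)
  then show ?thesis using r by (simp add: power2_eq_square)
qed

text \<open>By the dimension formula the sum of two lines has dimension at most 2.\<close>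

lemma span_Un_lines:
  assumes "A \<in> subspaces 1" "B \<in> subspaces 1"
  shows "span (A \<union> B) \<noteq> UNIV"
proof
  assume *: "span (A \<union> B) = UNIV"
  have A: "subspace A" "dim A = 1" "subspace B" "dim B = 1"
    using assms by (auto simp: subspaces_def)
  have "span A = A" "span B = B" using A by (simp_all only: span_eq_iff)
  with * have "{x + y |x y. x \<in> A \<and> y \<in> B} = UNIV" by (simp only: span_Un)
  then show False using dim_sums_Int[OF A(1) A(3)] A dim3 by simp
qed

section \<open>Vertices, edges and triangles of the subspace graph\<close>

lemma proper_subspace_iff:
  "subspace A \<and> A \<noteq> {0} \<and> A \<noteq> UNIV \<longleftrightarrow> A \<in> subspaces 1 \<union> subspaces 2"
proof -
  have "dim A = 0 \<longleftrightarrow> A = {0}" if "subspace A"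
    using that subspace_0 by (auto simp: dim_eq_0)
  moreover have "dim A = 3 \<longleftrightarrow> A = UNIV" if "subspace A"
    using that dim3 subspace_dim_equal[of A UNIV] by auto
  moreover have "dim A \<le> 3" using dim3 dim_subset[of A UNIV] by simp
  then have "dim A = 1 \<or> dim A = 2 \<longleftrightarrow> dim A \<noteq> 0 \<and> dim A \<noteq> 3" by linarith
  moreover have "A \<in> subspaces 1 \<union> subspaces 2 \<longleftrightarrow> subspace A \<and> (dim A = 1 \<or> dim A = 2)"
    by (auto simp: subspaces_def)
  ultimately show ?thesis by metis
qed

lemma lines_planes_disjoint: "subspaces 1 \<inter> subspaces 2 = {}"
  by (auto simp: subspaces_def)

text \<open>A plane spans everything with any subspace not inside it. Distinct planes are never
  nested, since their dimensions agree, and two lines are too small to span.\<close>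

lemma adjacent_iff:
  "{A, B} \<in> snd subspace_graph \<longleftrightarrow>
    (A \<in> subspaces 2 \<and> B \<in> subspaces 2 \<and> A \<noteq> B) \<or>
    (A \<in> subspaces 1 \<and> B \<in> subspaces 2 \<and> \<not> A \<subseteq> B) \<or>
    (A \<in> subspaces 2 \<and> B \<in> subspaces 1 \<and> \<not> B \<subseteq> A)" (is "_ \<longleftrightarrow> ?R A B")
proof -
  have "{A, B} \<in> snd subspace_graph \<longleftrightarrow> A \<in> subspaces 1 \<union> subspaces 2 \<and>
      B \<in> subspaces 1 \<union> subspaces 2 \<and> A \<noteq> B \<and> span (A \<union> B) = UNIV"
    unfolding subspace_graph_def snd_conv proper_subspace_iff
    by (auto simp: doubleton_eq_iff Un_commute)
  also have "\<dots> \<longleftrightarrow> ?R A B"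
  proof -
    have planes: "\<not> B \<subseteq> A" if "A \<in> subspaces 2" "B \<in> subspaces 2" "A \<noteq> B"
      using that subspace_dim_equal[of B A] by (auto simp: subspaces_def)
    have line_plane: "span (P \<union> Q) = UNIV \<longleftrightarrow> \<not> P \<subseteq> Q"
      if "P \<in> subspaces 1" "Q \<in> subspaces 2" for P Q
    proof
      assume *: "span (P \<union> Q) = UNIV"
      show "\<not> P \<subseteq> Q"
      proof
        assume "P \<subseteq> Q"
        then have "span Q = UNIV" using * by (simp add: Un_absorb1)
        then have "dim Q = 3" using dim3 dim_span[of Q] by simp
        then show False using that by (simp add: subspaces_def)
      qed
    qed (use span_Un_plane[OF that(2)] in \<open>simp add: Un_commute\<close>)
    show ?thesis
      using span_Un_lines[of A B] span_Un_plane[of A B] planes line_plane[of A B]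
        line_plane[of B A] lines_planes_disjoint
      by (auto simp: Un_commute)
  qed
  finally show ?thesis .
qed

text \<open>Lines are pairwise non-adjacent, so a triangle contains at most one. Triangles with a
  line are encoded as pairs of a two-element set of planes and a line off both, which prepares the
  count.\<close>

lemma triangles_subspace_graph:
  "triangles subspace_graph = {T. T \<subseteq> subspaces 2 \<and> card T = 3} \<union>
    (\<lambda>(S, P). insert P S) ` (SIGMA S:{S. S \<subseteq> subspaces 2 \<and> card S = 2}.
      {P \<in> subspaces 1. \<forall>A\<in>S. \<not> P \<subseteq> A})" (is "_ = ?X \<union> ?f ` ?Y")
proof (intro equalityI subsetI)
  fix T assume T: "T \<in> triangles subspace_graph"
  then have T_card: "card T = 3" and T_sub: "T \<subseteq> subspaces 1 \<union> subspaces 2"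
    and adj: "\<And>A B. A \<in> T \<Longrightarrow> B \<in> T \<Longrightarrow> A \<noteq> B \<Longrightarrow> {A, B} \<in> snd subspace_graph"
    using proper_subspace_iff by (auto simp: triangles_def subspace_graph_def)
  show "T \<in> ?X \<union> ?f ` ?Y"
  proof (cases "T \<subseteq> subspaces 2")
    case False
    then obtain P where P: "P \<in> T" "P \<in> subspaces 1" using T_sub by auto
    \<comment> \<open>Every other vertex is adjacent to the line \<open>P\<close>, which only planes
      not containing \<open>P\<close> can be.\<close>
    have "A \<in> subspaces 2 \<and> \<not> P \<subseteq> A" if "A \<in> T - {P}" for A
      using adj[of P A] that P lines_planes_disjoint unfolding adjacent_iff by auto
    then have "(T - {P}, P) \<in> ?Y" using P T_card by auto
    moreover have "T = ?f (T - {P}, P)" using P by auto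
    ultimately show ?thesis by blast
  qed (use T_card in auto)
next
  fix T assume "T \<in> ?X \<union> ?f ` ?Y"
  then show "T \<in> triangles subspace_graph"
  proof
    assume "T \<in> ?X"
    then show ?thesis
      using proper_subspace_iff unfolding triangles_def mem_Collect_eq adjacent_iff
      by (auto simp: subspace_graph_def)
  next
    assume "T \<in> ?f ` ?Y"
    then obtain S P where T: "T = insert P S" and S: "S \<subseteq> subspaces 2" "card S = 2"
      and P: "P \<in> subspaces 1" "\<forall>A\<in>S. \<not> P \<subseteq> A" by auto
    have "P \<notin> S" using S P lines_planes_disjoint by blast
    moreover have "finite S" using S(2) by (simp add: card_ge_0_finite)
    ultimately have "card T = 3" using S T by simp
    moreover have "T \<subseteq> fst subspace_graph"
      using T S P proper_subspace_iff by (auto simp: subspace_graph_def)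
    moreover have "{A, B} \<in> snd subspace_graph" if "A \<in> T" "B \<in> T" "A \<noteq> B" for A B
      unfolding adjacent_iff using that T S P by blast
    ultimately show ?thesis by (simp add: triangles_def)
  qed
qed

lemma card_triangles_subspace_graph:
  defines "n \<equiv> CARD('k)\<^sup>2 + CARD('k) + 1"
  shows "card (triangles subspace_graph) =
    (n choose 3) + (n choose 2) * (CARD('k)\<^sup>2 - CARD('k))"
proof -
  define X where "X = {T. T \<subseteq> subspaces 2 \<and> card T = 3}"
  define S2 where "S2 = {S. S \<subseteq> subspaces 2 \<and> card S = 2}"
  define Y where "Y = (SIGMA S:S2. {P \<in> subspaces 1. \<forall>A\<in>S. \<not> P \<subseteq> A})"
  define f where "f = (\<lambda>(S, P :: 'v set). insert P S)"
  have fin: "finite S2" by (auto simp: S2_def intro: finite_subset[of _ "Pow (subspaces 2)"])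
  have "inj_on f Y"
  \<comment> \<open>The inverse recovers \<open>S\<close> as the planes of the triangle and
    \<open>P\<close> as its only line.\<close>
  proof (rule inj_on_inverseI[where g = "\<lambda>T. (T \<inter> subspaces 2, the_elem (T \<inter> subspaces 1))"])
    fix y assume "y \<in> Y"
    then obtain S P where y: "y = (S, P)" "S \<subseteq> subspaces 2" "P \<in> subspaces 1"
      by (auto simp: Y_def S2_def)
    then have "f y \<inter> subspaces 1 = {P}" "f y \<inter> subspaces 2 = S"
      using lines_planes_disjoint by (auto simp: f_def)
    then show "(f y \<inter> subspaces 2, the_elem (f y \<inter> subspaces 1)) = y" using y(1) by simp
  qed
  then have "card (f ` Y) = card Y" by (rule card_image)
  also have "\<dots> = (\<Sum>S\<in>S2. card {P \<in> subspaces 1. \<forall>A\<in>S. \<not> P \<subseteq> A})"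
    unfolding Y_def using fin by (intro card_SigmaI) auto
  also have "\<dots> = (\<Sum>S\<in>S2. CARD('k)\<^sup>2 - CARD('k))"
  proof (intro sum.cong refl)
    fix S assume "S \<in> S2"
    then obtain A B where S: "S = {A, B}" "A \<noteq> B" "A \<in> subspaces 2" "B \<in> subspaces 2"
      by (auto simp: S2_def card_2_iff)
    have "{P \<in> subspaces 1. \<forall>A\<in>S. \<not> P \<subseteq> A} = {P \<in> subspaces 1. \<not> P \<subseteq> A \<and> \<not> P \<subseteq> B}"
      using S(1) by auto
    then show "card {P \<in> subspaces 1. \<forall>A\<in>S. \<not> P \<subseteq> A} = CARD('k)\<^sup>2 - CARD('k)"
      using card_lines_off_planes[OF S(3,4,2)] by simp
  qed
  also have "\<dots> = (n choose 2) * (CARD('k)\<^sup>2 - CARD('k))"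
    by (simp add: S2_def n_subsets card_planes_dim3 n_def)
  finally have "card (f ` Y) = (n choose 2) * (CARD('k)\<^sup>2 - CARD('k))" .
  moreover have "card X = n choose 3"
    by (simp add: X_def n_subsets card_planes_dim3 n_def)
  moreover have "X \<inter> f ` Y = {}"
    using lines_planes_disjoint by (auto simp: X_def Y_def f_def)
  moreover have "finite X"
    by (auto simp: X_def intro: finite_subset[of _ "Pow (subspaces 2)"])
  moreover have "finite (f ` Y)" using fin by (auto simp: Y_def)
  moreover have "triangles subspace_graph = X \<union> f ` Y"
    unfolding triangles_subspace_graph X_def Y_def S2_def f_def ..
  ultimately show ?thesis by (simp add: card_Un_disjoint)
qed

lemma real_card_triangles_subspace_graph:
  defines "q \<equiv> real CARD('k)"
  shows "real (card (triangles subspace_graph)) =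
    q * (q + 1) * (4 * q ^ 4 + 2 * q ^ 3 + q ^ 2 - 3 * q - 1) / 6"
proof -
  define n where "n = CARD('k)\<^sup>2 + CARD('k) + 1"
  have n: "real n = q\<^sup>2 + q + 1" by (simp add: n_def q_def)
  \<comment> \<open>This makes the natural-number difference q^2 - q agree with the real
    one.\<close>
  have "CARD('k) \<le> CARD('k)\<^sup>2" by (simp add: power2_eq_square)
  then have "real (CARD('k)\<^sup>2 - CARD('k)) = q\<^sup>2 - q" by (simp add: of_nat_diff q_def)
  moreover have "real (n choose 2) = real n * (real n - 1) / 2"
    by (simp add: binomial_gbinomial gbinomial_prod_rev numeral_2_eq_2)
  moreover have "real (n choose 3) = real n * (real n - 1) * (real n - 2) / 6"
    by (simp add: binomial_gbinomial gbinomial_prod_rev numeral_3_eq_3 numeral_2_eq_2)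
  ultimately have "real (card (triangles subspace_graph)) =
      real n * (real n - 1) * (real n - 2) / 6 + real n * (real n - 1) / 2 * (q\<^sup>2 - q)"
    unfolding card_triangles_subspace_graph n_def[symmetric] by (simp only: of_nat_add of_nat_mult)
  \<comment> \<open>With n - 1 = q(q + 1), the sum is n(n - 1)/6 times (n - 2) + 3(q^2 - q) = 4q^2 -
    2q - 1, and (q^2 + q + 1)(4q^2 - 2q - 1) is the quartic of the claim.\<close>
  then show ?thesis unfolding n by (simp add: field_simps power_numeral_reduce)
qed

end

end

section \<open>From the Lie algebra to its subspaces\<close>

lemma (in lie_algebra) subspace_imp_lie_subalgebra:
  assumes decomp: "\<And>a. \<exists>s. a - scale s x \<in> derived_algebra"
    and "c \<noteq> 0" and ad: "\<And>v. v \<in> derived_algebra \<Longrightarrow> bracket x v = scale c v"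
    and S: "subspace S"
  shows "lie_subalgebra S"
proof -
  note bracket_simps = bracket_add_left bracket_add_right bracket_scale_left bracket_scale_right
  have skew: "bracket b a = - bracket a b" for a b
  proof -
    have "bracket (a + b) (a + b) = bracket b a + bracket a b"
      by (simp only: bracket_add_left bracket_add_right) (simp add: bracket_self)
    then have "bracket b a + bracket a b = 0" unfolding bracket_self by (rule sym)
    then show ?thesis by (simp only: eq_neg_iff_add_eq_0)
  qed
  \<comment> \<open>The three Jacobi terms for \<open>x\<close>, \<open>v\<close>, \<open>w\<close>
    are c[v,w], -c[v,w] and -c[v,w]. Their sum is -c[v,w], so [v,w] = 0 in every
    characteristic.\<close>
  have abelian: "bracket v w = 0" if v: "v \<in> derived_algebra" and w: "w \<in> derived_algebra" for v w
  proof -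
    have "bracket v w \<in> derived_algebra"
      unfolding derived_algebra_def by (intro span_base) auto
    then have "scale c (bracket v w) + bracket v (bracket w x) + bracket w (bracket x v) = 0"
      using jacobi[of x v w] ad by simp
    moreover have "bracket v (bracket w x) = - scale c (bracket v w)"
    proof -
      have "bracket w x = scale (- c) w" using skew[of x w] ad[OF w] by simp
      moreover have "bracket v (scale (- c) w) = - scale c (bracket v w)"
        unfolding bracket_scale_right by simp
      ultimately show ?thesis by (simp only:)
    qed
    moreover have "bracket w (bracket x v) = - scale c (bracket v w)"
      using ad[OF v] skew[of v w] by (simp add: bracket_scale_right)
    ultimately show ?thesis using \<open>c \<noteq> 0\<close> by simp
  qed
  have "bracket a b \<in> S" if ab: "a \<in> S" "b \<in> S" for a b
  proof -
    obtain s t where st: "a - scale s x \<in> derived_algebra" "b - scale t x \<in> derived_algebra"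
      using decomp by meson
    define v w where vw: "v = a - scale s x" "w = b - scale t x"
    have a: "a = scale s x + v" and b: "b = scale t x + w" by (simp_all add: vw)
    have "bracket v x = - scale c v" "bracket x w = scale c w" "bracket v w = 0"
      using st ad abelian skew[of x v] by (simp_all add: vw)
    then have "bracket a b = scale (s * c) w - scale (t * c) v"
      unfolding a b by (simp add: bracket_simps bracket_self)
    \<comment> \<open>Replacing \<open>w\<close> by \<open>b\<close> and \<open>v\<close> by
      \<open>a\<close> adds the multiple cst of \<open>x\<close> to both terms, and these cancel; so
      the bracket is a combination of \<open>a\<close> and \<open>b\<close>.\<close>
    also have "\<dots> = scale (c * s) b - scale (c * t) a"
      unfolding a b by (simp add: scale_right_distrib mult_ac)
    also have "\<dots> \<in> S" using S ab by (simp add: subspace_diff subspace_scale)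
    finally show ?thesis .
  qed
  with S show ?thesis by (simp add: lie_subalgebra_def)
qed

theorem proposition3p10:
  fixes scale :: "'k::{field,finite} \<Rightarrow> 'v::ab_group_add \<Rightarrow> 'v"
    and bracket :: "'v \<Rightarrow> 'v \<Rightarrow> 'v"
    and q :: nat
    and V :: "'v set"
  assumes "lie_algebra scale bracket"
    and "q = CARD('k)"
    and "vector_space.dim scale (UNIV :: 'v set) = 3"
    and "V = lie_algebra.derived_algebra scale bracket"
    and "vector_space.dim scale V = 2"
    and "\<exists>x c. x \<notin> V \<and> c \<noteq> 0 \<and> (\<forall>v\<in>V. lie_algebra.ad bracket x v = scale c v)"
  shows "real (card (triangles (lie_algebra.comaximal_graph scale bracket))) =
    real q * (real q + 1) *
      (4 * real q ^ 4 + 2 * real q ^ 3 + real q ^ 2 - 3 * real q - 1) / 6"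
proof -
  interpret lie_algebra scale bracket by fact
  obtain Basis where Basis: "independent Basis" "UNIV \<subseteq> span Basis" "card Basis = 3"
    using basis_exists[of UNIV] assms(3) by metis
  \<comment> \<open>The basis is finite because its \<open>card\<close> is 3 rather than 0.\<close>
  interpret finite_field_space scale Basis
    by unfold_locales (use Basis card_ge_0_finite[of Basis] in auto)
  obtain x c where x: "x \<notin> V" and c: "c \<noteq> 0" and ad: "\<And>v. v \<in> V \<Longrightarrow> bracket x v = scale c v"
    using assms(6) by (auto simp: ad_def)
  have span_V: "span V = V" by (simp add: assms(4) derived_algebra_def)
  \<comment> \<open>As \<open>x\<close> lies outside \<open>V\<close>, it raises the dimension from
    2 to 3; thus each vector is a multiple of \<open>x\<close> plus an element of
    \<open>V\<close>.\<close>
  have "dim (span (insert x V)) = dim (UNIV :: 'v set)"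
    using x assms(3,5) by (simp add: dim_insert span_V)
  then have "span (insert x V) = UNIV"
    using subspace_dim_equal[of "span (insert x V)" UNIV] by simp
  then have "a \<in> span (insert x V)" for a by simp
  then have decomp: "\<exists>s. a - scale s x \<in> derived_algebra" for a
    unfolding span_insert span_V by (simp add: assms(4))
  have sub: "lie_subalgebra S \<longleftrightarrow> subspace S" for S
    using subspace_imp_lie_subalgebra[OF decomp c] ad assms(4) lie_subalgebra_def by blast
  then have "lie_subalgebra = subspace" by blast
  \<comment> \<open>The generated subalgebra is the \<open>lie_subalgebra\<close> hull and
    \<open>span\<close> is the \<open>subspace\<close> hull, so equal predicates give equal
    graphs.\<close>
  then have "comaximal_graph = subspace_graph"
    by (simp add: comaximal_graph_def comaximal_vertices_def subspace_graph_def
        generated_subalgebra_def span_def)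
  then show ?thesis
    using real_card_triangles_subspace_graph[OF assms(3)] assms(2) by simp
qed

end
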